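(* Let $\lambda>0$, let $a,b,c$ be positive real numbers with $c-a-b-1>0$, and let $\eta\in\mathbb{D}$ (with $\lambda/|\eta|$ read as $+\infty$ if $\eta=0$). Define, for $z\in\mathbb{D}$, $$f_4(z)=z+\overline{\eta z\int_0^zF(a,b;c;\tau)\,d\tau},\quad f_5(z)=z+\overline{\eta z\left(F(a,b;c;z)-1\right)},\quad f_6(z)=z+\overline{\eta z^2F(a,b;c;z)}.$$ Then: (a) $f_4\in\Omega_{\mathcal{H}}^0(\lambda)$ if $F(a,b;c;1)<\dfrac{\lambda}{|\eta|}$. (b) $f_5\in\Omega_{\mathcal{H}}^0(\lambda)$ if $\left(\dfrac{ab}{c-a-b-1}\right)F(a,b;c;1)<\dfrac{\lambda}{|\eta|}$. (c) $f_6\in\Omega_{\mathcal{H}}^0(\lambda)$ if $\left(\dfrac{ab}{c-a-b-1}+1\right)F(a,b;c;1)<\dfrac{\lambda}{|\eta|}$.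
   Context: $\mathbb{D}=\{z\in\mathbb{C}:|z|<1\}$. $F(a,b;c;z)=\sum_{n=0}^\infty\frac{(a)_n(b)_n}{n!\,(c)_n}z^n$ is the Gaussian hypergeometric function, where $(x)_n=x(x+1)\cdots(x+n-1)$ for $n\in\mathbb{N}$ and $(x)_0=1$; the series converges absolutely for $|z|<1$, and also at $z=1$ if $c-a-b>0$. $\mathcal{H}^0$ is the class of complex-valued harmonic functions $f=h+\overline{g}$ on $\mathbb{D}$, where $h,g$ are analytic on $\mathbb{D}$ with $h(z)=z+\sum_{n\ge2}a_nz^n$ and $g(z)=\sum_{n\ge2}b_nz^n$. For $\lambda>0$, $\Omega_{\mathcal{H}}^0(\lambda)$ is the set of $f=h+\overline{g}\in\mathcal{H}^0$ such that $|h(z)-zh'(z)|<\lambda-|g(z)-zg'(z)|$ for all $z\in\mathbb{D}$. *)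

theory Defs
  imports "HOL-Complex_Analysis.Complex_Analysis"
begin

text \<open>The value is the sum of the series only where the series converges; outside that set it is
  arbitrary.\<close>

definition hypergeo ::
  "'a \<Rightarrow> 'a \<Rightarrow> 'a \<Rightarrow> 'a \<Rightarrow> 'a::{real_normed_field, banach}" where
  "hypergeo a b c z =
     (\<Sum>n. pochhammer a n * pochhammer b n / (fact n * pochhammer c n) * z ^ n)"

text \<open>\<open>f\<close> is twice continuously (real) differentiable with vanishing Laplacian. Here \<open>fx\<close>, \<open>fy\<close>
  are the first partial derivatives and \<open>fxx\<close>, \<open>fxy\<close>, \<open>fyx\<close>, \<open>fyy\<close> the second ones.\<close>

definition harmonic_fun_on :: "(complex \<Rightarrow> complex) \<Rightarrow> complex set \<Rightarrow> bool" where
  "harmonic_fun_on f S \<longleftrightarrow>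
     (\<exists>fx fy fxx fxy fyx fyy.
        continuous_on S fxx \<and> continuous_on S fxy \<and>
        continuous_on S fyx \<and> continuous_on S fyy \<and>
        (\<forall>z\<in>S.
           (f has_derivative (\<lambda>v. Re v *\<^sub>R fx z + Im v *\<^sub>R fy z)) (at z) \<and>
           (fx has_derivative (\<lambda>v. Re v *\<^sub>R fxx z + Im v *\<^sub>R fxy z)) (at z) \<and>
           (fy has_derivative (\<lambda>v. Re v *\<^sub>R fyx z + Im v *\<^sub>R fyy z)) (at z) \<and>
           fxx z + fyy z = 0))"

text \<open>\<open>f = h + cnj g\<close> on the unit disc, with \<open>h\<close>, \<open>g\<close> analytic and normalised by their power
  series. Only values on the disc matter.\<close>

definition H0_decomp ::
  "(complex \<Rightarrow> complex) \<Rightarrow> (complex \<Rightarrow> complex) \<Rightarrow> (complex \<Rightarrow> complex) \<Rightarrow> bool" where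
  "H0_decomp f h g \<longleftrightarrow>
     h analytic_on ball 0 1 \<and> g analytic_on ball 0 1 \<and>
     (\<exists>a. \<forall>z\<in>ball 0 1. (\<lambda>n. a (n + 2) * z ^ (n + 2)) sums (h z - z)) \<and>
     (\<exists>b. \<forall>z\<in>ball 0 1. (\<lambda>n. b (n + 2) * z ^ (n + 2)) sums g z) \<and>
     (\<forall>z\<in>ball 0 1. f z = h z + cnj (g z))"

definition class_H0 :: "(complex \<Rightarrow> complex) set" where
  "class_H0 = {f. harmonic_fun_on f (ball 0 1) \<and> (\<exists>h g. H0_decomp f h g)}"

text \<open>The pair \<open>(h, g)\<close> is determined by \<open>f\<close> on the disc, so the existential quantifier
  involves no choice.\<close>

definition Omega_H0 :: "real \<Rightarrow> (complex \<Rightarrow> complex) set" where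
  "Omega_H0 lam =
     {f \<in> class_H0. \<exists>h g. H0_decomp f h g \<and>
        (\<forall>z\<in>ball 0 1. cmod (h z - z * deriv h z) < lam - cmod (g z - z * deriv g z))}"

end

theory Submission
  imports Defs
begin

text \<open>If \<open>f z = z + cnj (g z)\<close> with \<open>g z = (\<Sum>n. b n * z ^ (n + 2))\<close>, then
  \<open>g z - z * g' z = - (\<Sum>n. (n + 1) * b n * z ^ (n + 2))\<close>, so that
  \<open>(\<Sum>n. (n + 1) * \<bar>b n\<bar>) < \<lambda>\<close> suffices for membership in the class. For the three functions this
  majorant is the sum of \<open>t n\<close>, \<open>n * t n\<close> and \<open>(n + 1) * t n\<close>, up to the factor \<open>\<bar>\<eta>\<bar>\<close>, where \<open>t n\<close>
  are the Taylor coefficients of \<open>F(a,b;c;z)\<close>. With \<open>u n = n * (c + n - 1) * t n\<close> one has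
  \<open>u (n + 1) - u n = (a * b - (c - a - b - 1) * n) * t n\<close>; as \<open>u \<ge> 0\<close>, telescoping
  gives convergence and bounds \<open>\<Sum>n. n * t n\<close> by \<open>a * b / (c - a - b - 1) * F(a,b;c;1)\<close>.\<close>

section \<open>Harmonicity and a coefficient criterion for the class\<close>

lemma summable_powser_in_disc:
  fixes B :: "nat \<Rightarrow> complex"
  assumes "summable (\<lambda>n. cmod (B n))" and "cmod z \<le> 1"
  shows "summable (\<lambda>n. B n * z ^ n)"
proof (rule summable_comparison_test'[OF assms(1)])
  show "norm (B n * z ^ n) \<le> cmod (B n)" for n
    using assms(2) by (simp add: norm_mult norm_power mult_left_le power_le_one)
qed

text \<open>By the Cauchy-Riemann equations \<open>cnj g\<close> has partial derivatives
  \<open>cnj g'\<close> and \<open>- \<i> * cnj g'\<close>. Differentiating again gives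
  \<open>cnj g''\<close> twice along the real direction and \<open>- cnj g''\<close> twice along the
  imaginary one, and these cancel.\<close>

lemma harmonic_fun_on_add_cnj:
  assumes g: "g holomorphic_on S" and S: "open S"
    and f: "\<And>z. z \<in> S \<Longrightarrow> f z = z + cnj (g z)"
  shows "harmonic_fun_on f S"
proof -
  define g1 g2 where "g1 = deriv g" and "g2 = deriv g1"
  have g1: "g1 holomorphic_on S" and g2: "g2 holomorphic_on S"
    unfolding g1_def g2_def using g S by (auto intro!: holomorphic_deriv)
  have cont: "continuous_on S g2"
    using g2 by (rule holomorphic_on_imp_continuous_on)
  have dg: "(g has_derivative (\<lambda>v. g1 z * v)) (at z)" if "z \<in> S" for z
    unfolding g1_def using holomorphic_derivI[OF g S that]
    by (simp add: has_field_derivative_def)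
  have dg1: "(g1 has_derivative (\<lambda>v. g2 z * v)) (at z)" if "z \<in> S" for z
    unfolding g2_def using holomorphic_derivI[OF g1 S that]
    by (simp add: has_field_derivative_def)
  have "(f has_derivative
      (\<lambda>v. Re v *\<^sub>R (1 + cnj (g1 z)) + Im v *\<^sub>R (\<i> - \<i> * cnj (g1 z)))) (at z)"
    if "z \<in> S" for z
  proof -
    have "((\<lambda>z. z + cnj (g z)) has_derivative (\<lambda>v. v + cnj (g1 z * v))) (at z)"
      by (intro derivative_intros has_derivative_cnj dg that)
    then have "(f has_derivative (\<lambda>v. v + cnj (g1 z * v))) (at z)"
      by (rule has_derivative_transform_within_open[OF _ S that]) (simp add: f)
    then show ?thesis
      by (rule has_derivative_eq_rhs) (auto simp: complex_eq_iff algebra_simps)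
  qed
  moreover have "((\<lambda>z. 1 + cnj (g1 z)) has_derivative
      (\<lambda>v. Re v *\<^sub>R cnj (g2 z) + Im v *\<^sub>R (- \<i> * cnj (g2 z)))) (at z)" if "z \<in> S" for z
  proof -
    have "((\<lambda>z. 1 + cnj (g1 z)) has_derivative (\<lambda>v. 0 + cnj (g2 z * v))) (at z)"
      by (intro derivative_intros has_derivative_cnj dg1 that)
    then show ?thesis
      by (rule has_derivative_eq_rhs) (auto simp: complex_eq_iff algebra_simps)
  qed
  moreover have "((\<lambda>z. \<i> - \<i> * cnj (g1 z)) has_derivative
      (\<lambda>v. Re v *\<^sub>R (- \<i> * cnj (g2 z)) + Im v *\<^sub>R (- cnj (g2 z)))) (at z)"
    if "z \<in> S" for z
  proof -
    have "((\<lambda>z. \<i> - \<i> * cnj (g1 z)) has_derivative (\<lambda>v. 0 - \<i> * cnj (g2 z * v))) (at z)"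
      by (intro derivative_intros has_derivative_cnj dg1 that)
    then show ?thesis
      by (rule has_derivative_eq_rhs) (auto simp: complex_eq_iff algebra_simps)
  qed
  moreover have "continuous_on S (\<lambda>z. cnj (g2 z))" "continuous_on S (\<lambda>z. - \<i> * cnj (g2 z))"
    "continuous_on S (\<lambda>z. - cnj (g2 z))"
    by (intro continuous_intros cont)+
  \<comment> \<open>The mixed partials coincide, so five functions fill six existential
    quantifiers.\<close>
  ultimately show ?thesis
    unfolding harmonic_fun_on_def
    by (intro exI[of _ "\<lambda>z. 1 + cnj (g1 z)"] exI[of _ "\<lambda>z. \<i> - \<i> * cnj (g1 z)"]
      exI[of _ "\<lambda>z. cnj (g2 z)"] exI[of _ "\<lambda>z. - \<i> * cnj (g2 z)"]
      exI[of _ "\<lambda>z. - cnj (g2 z)"]) simp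
qed

text \<open>Taking the factor \<open>z\<^sup>2\<close> out of \<open>g\<close> makes the
  normalisation of \<open>g\<close> automatic. As \<open>h\<close> is the identity,
  \<open>h z - z * h' z\<close> vanishes and only the bound on \<open>g\<close> is left.\<close>

lemma Omega_H0_powser:
  fixes B :: "nat \<Rightarrow> complex"
  assumes f: "\<And>z. z \<in> ball 0 1 \<Longrightarrow> f z = z + cnj (z\<^sup>2 * (\<Sum>n. B n * z ^ n))"
    and sB: "summable (\<lambda>n. real (Suc n) * cmod (B n))"
    and lt: "(\<Sum>n. real (Suc n) * cmod (B n)) < lam"
  shows "f \<in> Omega_H0 lam"
proof -
  define k where "k = (\<lambda>z. \<Sum>n. B n * z ^ n)"
  define g where "g = (\<lambda>z. z\<^sup>2 * k z)"
  have "summable (\<lambda>n. cmod (B n))"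
    by (rule summable_comparison_test'[OF sB]) (simp add: distrib_right)
  then have sm: "summable (\<lambda>n. B n * z ^ n)" if "cmod z < 1" for z
    using that by (intro summable_powser_in_disc) auto
  define k' where "k' = (\<lambda>z. \<Sum>n. diffs B n * z ^ n)"
  have dk: "(k has_field_derivative k' z) (at z)" if "cmod z < 1" for z
    unfolding k_def k'_def by (rule termdiffs_strong'[OF sm that])
  have dg: "(g has_field_derivative (2 * z * k z + z\<^sup>2 * k' z)) (at z)" if "cmod z < 1" for z
    unfolding g_def by (rule derivative_eq_intros dk that refl | simp)+
  have hol: "g holomorphic_on ball 0 1"
    by (rule holomorphic_onI) (use dg in \<open>auto simp: field_differentiable_def
      intro: has_field_derivative_at_within\<close>)
  have gs: "(\<lambda>n. B n * z ^ (n + 2)) sums g z" if "cmod z < 1" for z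
    using sums_mult[OF summable_sums[OF sm[OF that]], of "z\<^sup>2"]
    by (simp add: g_def k_def power_add power2_eq_square mult_ac)
  have dec: "H0_decomp f (\<lambda>z. z) g"
    unfolding H0_decomp_def
  proof (intro conjI)
    show "\<exists>a. \<forall>z\<in>ball 0 1. (\<lambda>n. a (n + 2) * z ^ (n + 2)) sums (z - z :: complex)"
      by (rule exI[of _ "\<lambda>_. 0"]) simp
    \<comment> \<open>Only indices from 2 on are read, so the truncated subtraction in the witness
      does no harm.\<close>
    show "\<exists>b. \<forall>z\<in>ball 0 1. (\<lambda>n. b (n + 2) * z ^ (n + 2)) sums g z"
      by (rule exI[of _ "\<lambda>n. B (n - 2)"]) (use gs in simp)
    show "\<forall>z\<in>ball 0 1. f z = z + cnj (g z)"
      by (simp add: f g_def k_def)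
  qed (use hol in \<open>auto simp: analytic_on_open\<close>)
  have bound: "cmod (g z - z * deriv g z) < lam" if z: "cmod z < 1" for z
  proof -
    have "summable (\<lambda>n. diffs B n * z ^ n)"
      by (rule termdiff_converges[OF z sm])
    from sums_mult[OF diffs_equiv[OF this], of z]
    have "(\<lambda>n. z * (of_nat n * B n * z ^ (n - Suc 0))) sums (z * k' z)"
      by (simp add: k'_def)
    \<comment> \<open>At \<open>n = 0\<close> the exponent is truncated, but the factor
      \<open>of_nat n\<close> makes both sides zero.\<close>
    moreover have "z * (of_nat n * B n * z ^ (n - Suc 0)) = of_nat n * B n * z ^ n" for n
      by (cases n) auto
    ultimately have "(\<lambda>n. B n * z ^ n + of_nat n * B n * z ^ n) sums (k z + z * k' z)"
      unfolding k_def by (intro sums_add summable_sums sm z) simp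
    then have sums: "(\<lambda>n. of_nat (Suc n) * B n * z ^ n) sums (k z + z * k' z)"
      by (simp add: algebra_simps)
    have le: "cmod (of_nat (Suc n) * B n * z ^ n) \<le> real (Suc n) * cmod (B n)" for n
      unfolding norm_mult norm_power norm_of_nat using z
      by (intro mult_left_le power_le_one) auto
    have "cmod (k z + z * k' z) \<le> (\<Sum>n. real (Suc n) * cmod (B n))"
      unfolding sums_unique[OF sums] by (rule norm_suminf_le[OF le sB])
    moreover have "g z = z\<^sup>2 * k z"
      by (simp add: g_def)
    then have "g z - z * deriv g z = - (z\<^sup>2 * (k z + z * k' z))"
      by (simp add: DERIV_imp_deriv[OF dg[OF z]] algebra_simps power2_eq_square)
    then have "cmod (g z - z * deriv g z) \<le> cmod (k z + z * k' z)"
      using z by (simp add: norm_mult norm_power mult_left_le_one_le power_le_one)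
    ultimately show ?thesis using lt by linarith
  qed
  have "harmonic_fun_on f (ball 0 1)"
    using hol open_ball by (rule harmonic_fun_on_add_cnj) (simp add: f g_def k_def)
  moreover have "\<forall>z\<in>ball 0 1. cmod (z - z * deriv (\<lambda>z. z) z) < lam - cmod (g z - z * deriv g z)"
    using bound by simp
  ultimately show ?thesis
    unfolding Omega_H0_def class_H0_def using dec by blast
qed

section \<open>Coefficients of the hypergeometric series\<close>

definition hyp_coeff :: "real \<Rightarrow> real \<Rightarrow> real \<Rightarrow> nat \<Rightarrow> real" where
  "hyp_coeff a b c n = pochhammer a n * pochhammer b n / (fact n * pochhammer c n)"

text \<open>With real parameters every estimate can be made on real coefficients; complex numbers
  enter only through \<open>z\<close>.\<close>

lemma hypergeo_of_real:
  "hypergeo (of_real a) (of_real b) (of_real c) z =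
     (\<Sum>n. complex_of_real (hyp_coeff a b c n) * z ^ n)"
  by (simp add: hypergeo_def hyp_coeff_def pochhammer_of_real)

lemma hypergeo_at_1: "hypergeo a b c 1 = (\<Sum>n. hyp_coeff a b c n)"
  by (simp add: hypergeo_def hyp_coeff_def)

lemma hyp_coeff_0 [simp]: "hyp_coeff a b c 0 = 1"
  by (simp add: hyp_coeff_def)

context
  fixes a b c :: real
  assumes pos: "a > 0" "b > 0" "c > 0"
begin

lemma hyp_coeff_nonneg: "hyp_coeff a b c n \<ge> 0"
  using pos by (simp add: hyp_coeff_def pochhammer_nonneg)

lemma hyp_coeff_Suc:
  "real (Suc n) * (c + real n) * hyp_coeff a b c (Suc n) =
     (a + real n) * (b + real n) * hyp_coeff a b c n"
proof -
  have "pochhammer c n > 0" "c + real n > 0"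
    using pos by (auto intro: pochhammer_pos)
  then show ?thesis
    by (simp add: hyp_coeff_def pochhammer_Suc divide_simps)
qed

text \<open>By the recurrence, consecutive right-hand sides differ by
  \<open>(a + n) * (b + n) - n * (c + n - 1)\<close> times the coefficient; the squares of
  \<open>n\<close> cancel and a linear factor remains.\<close>

lemma hyp_coeff_telescope:
  "(\<Sum>n<N. (a * b - (c - a - b - 1) * real n) * hyp_coeff a b c n) =
     real N * (c + real N - 1) * hyp_coeff a b c N"
proof (induction N)
  case (Suc N)
  have "real (Suc N) * (c + real (Suc N) - 1) * hyp_coeff a b c (Suc N) =
      (a + real N) * (b + real N) * hyp_coeff a b c N"
    using hyp_coeff_Suc[of N] by simp
  then show ?case using Suc by (simp add: algebra_simps)
qed simp

lemma sum_hyp_coeff_le: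
  "(c - a - b - 1) * (\<Sum>n<N. real n * hyp_coeff a b c n) \<le> a * b * (\<Sum>n<N. hyp_coeff a b c n)"
proof -
  \<comment> \<open>For \<open>N = 0\<close> the middle factor may be negative, but then the first
    one vanishes; for \<open>N > 0\<close> it is at least \<open>c\<close>.\<close>
  have "real N * (c + real N - 1) * hyp_coeff a b c N \<ge> 0"
    using pos hyp_coeff_nonneg[of N] by (cases N) auto
  then show ?thesis
    unfolding hyp_coeff_telescope[symmetric]
    by (simp add: left_diff_distrib sum_subtractf sum_distrib_left mult.assoc)
qed

context
  assumes gap: "c - a - b - 1 > 0"
begin

text \<open>\<open>sum_hyp_coeff_le\<close> bounds the weighted partial sums by unweighted ones,
  which are not yet known to be bounded. Beyond a fixed \<open>M\<close> the latter are absorbed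
  into half of the left-hand side, leaving a bound independent of \<open>N\<close>.\<close>

lemma summable_of_nat_mult_hyp_coeff: "summable (\<lambda>n. real n * hyp_coeff a b c n)"
proof -
  define d where "d = c - a - b - 1"
  \<comment> \<open>Chosen so that \<open>a * b \<le> d / 2 * n\<close> for all
    \<open>n \<ge> M\<close>.\<close>
  obtain M :: nat where M: "real M \<ge> 2 * a * b / d"
    using real_arch_simple by blast
  have d: "d > 0" using gap by (simp add: d_def)
  have head: "a * b * hyp_coeff a b c n \<le>
      a * b * (if n < M then hyp_coeff a b c n else 0) + d / 2 * (real n * hyp_coeff a b c n)" for n
  proof (cases "n < M")
    case True
    then show ?thesis using d hyp_coeff_nonneg[of n] by simp
  next
    case False
    then have "2 * a * b / d \<le> real n" using M by linarith
    then have "a * b \<le> d / 2 * real n" using d by (simp add: field_simps)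
    from mult_right_mono[OF this hyp_coeff_nonneg[of n]] False show ?thesis
      by (simp add: mult.assoc)
  qed
  have "(\<Sum>n<N. real n * hyp_coeff a b c n) \<le> 2 * a * b / d * (\<Sum>n<M. hyp_coeff a b c n)" for N
  proof -
    have "d * (\<Sum>n<N. real n * hyp_coeff a b c n) \<le> (\<Sum>n<N. a * b * hyp_coeff a b c n)"
      using sum_hyp_coeff_le[of N] by (simp add: d_def sum_distrib_left)
    also have "\<dots> \<le> (\<Sum>n<N. a * b * (if n < M then hyp_coeff a b c n else 0) +
        d / 2 * (real n * hyp_coeff a b c n))"
      by (intro sum_mono head)
    also have "\<dots> = a * b * (\<Sum>n<N. if n < M then hyp_coeff a b c n else 0) +
        d / 2 * (\<Sum>n<N. real n * hyp_coeff a b c n)"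
      by (simp add: sum.distrib sum_distrib_left)
    also have "(\<Sum>n<N. if n < M then hyp_coeff a b c n else 0) =
        (\<Sum>n\<in>{..<N} \<inter> {..<M}. hyp_coeff a b c n)"
      by (simp add: sum.inter_restrict)
    also have "a * b * \<dots> \<le> a * b * (\<Sum>n<M. hyp_coeff a b c n)"
      using pos by (intro mult_left_mono sum_mono2 hyp_coeff_nonneg) auto
    \<comment> \<open>Moving the half-weighted sum to the left leaves the factor
      \<open>d / 2\<close> there.\<close>
    finally show ?thesis using d by (simp add: field_simps)
  qed
  then show ?thesis
    by (intro summableI_nonneg_bounded) (auto intro!: mult_nonneg_nonneg hyp_coeff_nonneg)
qed

text \<open>The weight \<open>n\<close> is at least 1 except at \<open>n = 0\<close>, hence the
  comparison of shifted series.\<close>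

lemma summable_hyp_coeff: "summable (hyp_coeff a b c)"
proof -
  have "summable (\<lambda>n. hyp_coeff a b c (Suc n))"
  proof (rule summable_comparison_test')
    show "summable (\<lambda>n. real (Suc n) * hyp_coeff a b c (Suc n))"
      using summable_of_nat_mult_hyp_coeff
        summable_Suc_iff[of "\<lambda>n. real n * hyp_coeff a b c n"] by blast
    show "norm (hyp_coeff a b c (Suc n)) \<le> real (Suc n) * hyp_coeff a b c (Suc n)" for n
      using hyp_coeff_nonneg[of "Suc n"] mult_right_mono[of 1 "real (Suc n)"] by simp
  qed
  then show ?thesis by (simp only: summable_Suc_iff)
qed

text \<open>Both series now converge, so the inequality between partial sums passes to the
  limit.\<close>

lemma suminf_of_nat_mult_hyp_coeff_le:
  "(\<Sum>n. real n * hyp_coeff a b c n) \<le> a * b / (c - a - b - 1) * hypergeo a b c 1"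
proof -
  have "(c - a - b - 1) * (\<Sum>n. real n * hyp_coeff a b c n) \<le> a * b * (\<Sum>n. hyp_coeff a b c n)"
    using sum_hyp_coeff_le
    by (intro LIMSEQ_le[OF tendsto_mult_left[OF summable_LIMSEQ[OF summable_of_nat_mult_hyp_coeff]]
      tendsto_mult_left[OF summable_LIMSEQ[OF summable_hyp_coeff]]]) blast
  then show ?thesis
    using gap by (simp add: hypergeo_at_1 field_simps)
qed

lemma summable_Suc_mult_hyp_coeff: "summable (\<lambda>n. real (Suc n) * hyp_coeff a b c n)"
  using summable_add[OF summable_of_nat_mult_hyp_coeff summable_hyp_coeff]
  by (simp add: algebra_simps)

lemma suminf_Suc_mult_hyp_coeff_le:
  "(\<Sum>n. real (Suc n) * hyp_coeff a b c n) \<le> (a * b / (c - a - b - 1) + 1) * hypergeo a b c 1"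
  using suminf_add[OF summable_of_nat_mult_hyp_coeff summable_hyp_coeff]
    suminf_of_nat_mult_hyp_coeff_le
  by (simp add: algebra_simps hypergeo_at_1)

section \<open>Power series on the disc attached to the hypergeometric function\<close>

lemma summable_hyp_coeff_powser:
  assumes "cmod z < 1"
  shows "summable (\<lambda>n. complex_of_real (hyp_coeff a b c n) * z ^ n)"
  using assms summable_hyp_coeff
  by (intro summable_powser_in_disc) (auto simp: hyp_coeff_nonneg)

text \<open>Supplies the second factor \<open>z\<close> that the co-analytic part of
  \<open>f5\<close> needs for the coefficient criterion.\<close>

lemma hypergeo_minus_1:
  assumes "cmod z < 1"
  shows "hypergeo (of_real a) (of_real b) (of_real c) z - 1 =
    z * (\<Sum>n. complex_of_real (hyp_coeff a b c (Suc n)) * z ^ n)"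
proof -
  have "summable (\<lambda>n. complex_of_real (hyp_coeff a b c (Suc n)) * z ^ n)"
    using assms summable_hyp_coeff
    by (intro summable_powser_in_disc) (auto simp: hyp_coeff_nonneg summable_Suc_iff)
  from suminf_mult[OF this, of z] suminf_split_head[OF summable_hyp_coeff_powser[OF assms]]
  show ?thesis by (simp add: hypergeo_of_real mult_ac)
qed

text \<open>Termwise integration: the power series with coefficients \<open>C\<close> is a primitive
  on the disc, and the segment from 0 to \<open>z\<close> stays inside.\<close>

lemma contour_integral_hypergeo:
  assumes z: "cmod z < 1"
  shows "contour_integral (linepath 0 z) (\<lambda>\<tau>. hypergeo (of_real a) (of_real b) (of_real c) \<tau>) =
    z * (\<Sum>n. complex_of_real (hyp_coeff a b c n / real (Suc n)) * z ^ n)"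
proof -
  \<comment> \<open>Division by zero yields \<open>C 0 = 0\<close>, so the primitive vanishes at
    0.\<close>
  define C where "C n = complex_of_real (hyp_coeff a b c (n - 1) / real n)" for n
  have sC': "summable (\<lambda>n. cmod (C (Suc n)))"
  proof (rule summable_comparison_test'[OF summable_hyp_coeff])
    show "norm (cmod (C (Suc n))) \<le> hyp_coeff a b c n" for n
      using mult_left_mono[OF _ hyp_coeff_nonneg, of 1 "real (Suc n)" n]
      by (simp add: C_def hyp_coeff_nonneg norm_divide divide_le_eq del: of_nat_Suc)
  qed
  then have "summable (\<lambda>n. cmod (C n))"
    using summable_Suc_iff[of "\<lambda>n. cmod (C n)"] by blast
  then have sC: "summable (\<lambda>n. C n * w ^ n)" if "cmod w < 1" for w
    using that by (intro summable_powser_in_disc) auto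
  have diffs_C: "diffs C = (\<lambda>n. complex_of_real (hyp_coeff a b c n))"
    by (simp add: fun_eq_iff diffs_def C_def del: of_nat_Suc)
  have deriv: "((\<lambda>w. \<Sum>n. C n * w ^ n) has_field_derivative
      hypergeo (of_real a) (of_real b) (of_real c) w) (at w within ball 0 1)"
    if "w \<in> ball 0 1" for w
    using termdiffs_strong'[where z = w, OF sC] that
    by (auto simp: diffs_C hypergeo_of_real intro: has_field_derivative_at_within)
  have "path_image (linepath 0 z) \<subseteq> ball 0 1"
    using z by (simp add: closed_segment_subset)
  then have "contour_integral (linepath 0 z)
      (\<lambda>\<tau>. hypergeo (of_real a) (of_real b) (of_real c) \<tau>) =
      (\<Sum>n. C n * z ^ n) - (\<Sum>n. C n * 0 ^ n)"
    using contour_integral_unique[OF contour_integral_primitive[OF deriv, of "linepath 0 z"]]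
    by simp
  also have "(\<Sum>n. C n * 0 ^ n) = 0"
    unfolding powser_zero by (simp add: C_def)
  also have "(\<Sum>n. C n * z ^ n) = z * (\<Sum>n. C (Suc n) * z ^ n)"
    using suminf_split_head[OF sC[OF z]]
      suminf_mult[OF summable_powser_in_disc[OF sC', of z], of z] z
    by (simp add: C_def mult_ac)
  finally show ?thesis by (simp only: C_def diff_Suc_1 diff_zero)
qed

end

end

section \<open>Membership of the three functions\<close>

theorem theorem2p8:
  fixes lam a b c :: real and \<eta> :: complex
    and f4 f5 f6 :: "complex \<Rightarrow> complex"
  assumes "lam > 0" and "a > 0" and "b > 0" and "c > 0"
    and "c - a - b - 1 > 0"
    and "\<eta> \<in> ball 0 1"
    and "\<And>z. z \<in> ball 0 1 \<Longrightarrow>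
           f4 z = z + cnj (\<eta> * z * contour_integral (linepath 0 z)
             (\<lambda>\<tau>. hypergeo (of_real a) (of_real b) (of_real c) \<tau>))"
    and "\<And>z. z \<in> ball 0 1 \<Longrightarrow>
           f5 z = z + cnj (\<eta> * z * (hypergeo (of_real a) (of_real b) (of_real c) z - 1))"
    and "\<And>z. z \<in> ball 0 1 \<Longrightarrow>
           f6 z = z + cnj (\<eta> * z\<^sup>2 * hypergeo (of_real a) (of_real b) (of_real c) z)"
  shows "((\<eta> \<noteq> 0 \<longrightarrow> hypergeo a b c 1 < lam / cmod \<eta>) \<longrightarrow> f4 \<in> Omega_H0 lam)
    \<and> ((\<eta> \<noteq> 0 \<longrightarrow> a * b / (c - a - b - 1) * hypergeo a b c 1 < lam / cmod \<eta>)
         \<longrightarrow> f5 \<in> Omega_H0 lam)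
    \<and> ((\<eta> \<noteq> 0 \<longrightarrow> (a * b / (c - a - b - 1) + 1) * hypergeo a b c 1 < lam / cmod \<eta>)
         \<longrightarrow> f6 \<in> Omega_H0 lam)"
proof -
  have pos: "a > 0" "b > 0" "c > 0" and gap: "c - a - b - 1 > 0"
    using assms by auto
  note nonneg = hyp_coeff_nonneg[OF pos]
  \<comment> \<open>For \<eta> = 0 the bound is read as infinite; the product is then 0, which is
    below \<open>lam\<close>.\<close>
  have scaled: "cmod \<eta> * S < lam" if "S \<le> T" "\<eta> \<noteq> 0 \<longrightarrow> T < lam / cmod \<eta>" for S T
  proof (cases "\<eta> = 0")
    case False
    then have "S < lam / cmod \<eta>" using that by simp
    then show ?thesis using False by (simp add: field_simps)
  qed (use \<open>lam > 0\<close> in simp)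
  \<comment> \<open>The criterion with \<open>B n = \<eta> * s n\<close> and real
    \<open>s n \<ge> 0\<close>; the three functions differ only in \<open>s\<close>.\<close>
  have member: "f \<in> Omega_H0 lam"
    if f: "\<And>z. z \<in> ball 0 1 \<Longrightarrow> f z = z + cnj (\<eta> * z\<^sup>2 * (\<Sum>n. complex_of_real (s n) * z ^ n))"
      and s: "\<And>n. s n \<ge> 0" and sm: "summable (\<lambda>n. real (Suc n) * s n)"
      and T: "(\<Sum>n. real (Suc n) * s n) \<le> T" "\<eta> \<noteq> 0 \<longrightarrow> T < lam / cmod \<eta>"
    for f s T
  proof (rule Omega_H0_powser)
    have eq: "real (Suc n) * cmod (\<eta> * complex_of_real (s n)) = cmod \<eta> * (real (Suc n) * s n)" for n
      using s[of n] by (simp add: norm_mult)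
    show "summable (\<lambda>n. real (Suc n) * cmod (\<eta> * complex_of_real (s n)))"
      unfolding eq by (rule summable_mult[OF sm])
    show "(\<Sum>n. real (Suc n) * cmod (\<eta> * complex_of_real (s n))) < lam"
      unfolding eq suminf_mult[OF sm] by (rule scaled[OF T])
    have "summable (\<lambda>n. cmod (complex_of_real (s n)))"
      by (rule summable_comparison_test'[OF sm])
        (use s in \<open>simp add: distrib_right\<close>)
    then show "f z = z + cnj (z\<^sup>2 * (\<Sum>n. \<eta> * complex_of_real (s n) * z ^ n))"
      if "z \<in> ball 0 1" for z
      using f[OF that] that
        suminf_mult[OF summable_powser_in_disc[of "\<lambda>n. complex_of_real (s n)" z], of \<eta>]
      by (simp add: mult_ac)
  qed
  show ?thesis
  proof (intro conjI impI)
    assume T: "\<eta> \<noteq> 0 \<longrightarrow> hypergeo a b c 1 < lam / cmod \<eta>"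
    \<comment> \<open>Integration divides by exactly the weight \<open>Suc n\<close> of the
      criterion, so the majorant is F(a,b;c;1) itself.\<close>
    have eq: "real (Suc n) * (hyp_coeff a b c n / real (Suc n)) = hyp_coeff a b c n" for n
      by simp
    show "f4 \<in> Omega_H0 lam"
    proof (rule member[OF _ _ _ _ T])
      show "f4 z = z + cnj (\<eta> * z\<^sup>2 *
          (\<Sum>n. complex_of_real (hyp_coeff a b c n / real (Suc n)) * z ^ n))"
        if "z \<in> ball 0 1" for z
        using that unfolding assms(7)[OF that]
        by (subst contour_integral_hypergeo[OF pos gap]) (auto simp: power2_eq_square mult_ac)
    qed (unfold eq hypergeo_at_1, use nonneg summable_hyp_coeff[OF pos gap] in auto)
  next
    assume T: "\<eta> \<noteq> 0 \<longrightarrow> a * b / (c - a - b - 1) * hypergeo a b c 1 < lam / cmod \<eta>"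
    \<comment> \<open>Here \<open>s n\<close> is the coefficient of index \<open>Suc n\<close>; the
      majorant is the series weighted by \<open>n\<close>, whose term at index 0 is zero.\<close>
    note sm = summable_of_nat_mult_hyp_coeff[OF pos gap]
    show "f5 \<in> Omega_H0 lam"
    proof (rule member[OF _ _ _ _ T])
      show "f5 z = z + cnj (\<eta> * z\<^sup>2 * (\<Sum>n. complex_of_real (hyp_coeff a b c (Suc n)) * z ^ n))"
        if "z \<in> ball 0 1" for z
        using that assms(8)[OF that] hypergeo_minus_1[OF pos gap, of z]
        by (simp add: power2_eq_square mult_ac)
      show "summable (\<lambda>n. real (Suc n) * hyp_coeff a b c (Suc n))"
        using sm summable_Suc_iff[of "\<lambda>n. real n * hyp_coeff a b c n"] by blast
      show "(\<Sum>n. real (Suc n) * hyp_coeff a b c (Suc n)) \<le>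
          a * b / (c - a - b - 1) * hypergeo a b c 1"
        using suminf_split_head[OF sm] suminf_of_nat_mult_hyp_coeff_le[OF pos gap] by simp
    qed (rule nonneg)
  next
    assume T: "\<eta> \<noteq> 0 \<longrightarrow> (a * b / (c - a - b - 1) + 1) * hypergeo a b c 1 < lam / cmod \<eta>"
    show "f6 \<in> Omega_H0 lam"
      by (rule member[OF _ nonneg summable_Suc_mult_hyp_coeff[OF pos gap]
            suminf_Suc_mult_hyp_coeff_le[OF pos gap] T])
        (simp add: assms(9) hypergeo_of_real)
  qed
qed

end
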